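(* Let $\delta\in(0,1)$ and let $M_r\in\mathbb{R}^{\rho_r\times p}$, $M_c\in\mathbb{R}^{n\times\rho_c}$ be subsampling matrices such that $$(1-\delta)\,\|Y\|_F^2\le\frac{np}{\rho_r\rho_c}\,\|M_rYM_c\|_F^2\le(1+\delta)\,\|Y\|_F^2\quad\text{for all }Y\in\mathcal{LR}(P_{k_r},Q_{k_c}).$$ Assume $\lambda_{k_r+1}>0$, $\lambda_{k_c+1}>0$. Let $\bar U\in\mathbb{R}^{p\times k}$ have all columns in $\mathrm{span}(P_{k_r})$, let $\bar V\in\mathbb{R}^{n\times k}$ have all columns in $\mathrm{span}(Q_{k_c})$, and set $\tilde U=M_r\bar U$, $\tilde V=M_c^\top\bar V$. Let $U^*$ and $V^*$ be solutions of $$\min_{U\in\mathbb{R}^{p\times k}}\mathrm{tr}(U^\top\mathcal{L}_rU)\ \text{ s.t. }M_rU=\tilde U\qquad\text{and}\qquad\min_{V\in\mathbb{R}^{n\times k}}\mathrm{tr}(V^\top\mathcal{L}_cV)\ \text{ s.t. }M_c^\top V=\tilde V,$$ respectively. Put $\bar U^*=P_{k_r}P_{k_r}^\top U^*$ and $\bar V^*=Q_{k_c}Q_{k_c}^\top V^*$. Then $$\|\bar U^*-\bar U\|_F\le\sqrt{\frac{2p}{\rho_r(1-\delta)}}\,\sqrt{\frac{\lambda_{k_r}}{\lambda_{k_r+1}}}\ \|\bar U\|_F\qquad\text{and}\qquad\|\bar V^*-\bar V\|_F\le\sqrt{\frac{2n}{\rho_c(1-\delta)}}\,\sqrt{\frac{\lambda_{k_c}}{\lambda_{k_c+1}}}\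 \|\bar V\|_F.$$
   Context: $\mathcal{L}_c\in\mathbb{R}^{n\times n}$ and $\mathcal{L}_r\in\mathbb{R}^{p\times p}$ are Laplacians of two undirected graphs with nonnegative weights (on the columns and on the rows of $p\times n$ data matrices). Write $\mathcal{L}_c=Q\Lambda_cQ^\top$, $\mathcal{L}_r=P\Lambda_rP^\top$ with $Q,P$ orthogonal and eigenvalues sorted in increasing order; $Q_{k_c}\in\mathbb{R}^{n\times k_c}$ and $P_{k_r}\in\mathbb{R}^{p\times k_r}$ consist of the first $k_c$ columns of $Q$ and the first $k_r$ columns of $P$, with $k_c<n$, $k_r<p$. The symbols $\lambda_{k_c},\lambda_{k_c+1}$ denote the $k_c$-th and $(k_c+1)$-th smallest eigenvalues of $\mathcal{L}_c$, and $\lambda_{k_r},\lambda_{k_r+1}$ denote the $k_r$-th and $(k_r+1)$-th smallest eigenvalues of $\mathcal{L}_r$ (the subscript indicates which Laplacian is meant). $k\ge1$ is the number of columns of the matrices $U,V$. $\mathcal{LR}(P_{k_r},Q_{k_c})$ is the set of matrices $Y\in\mathbb{R}^{p\times n}$ all of whose columns lie in $\mathrm{span}(P_{k_r})$ and all of whose rows (viewed as vectors of $\mathbb{R}^n$) lie in $\mathrm{span}(Q_{k_c})$, where span of a matrix means the span of its columns. Subsampling matrices: for distinct indices $\omega_1,\dots,\omega_{\rho_c}\in\{1,\dots,n\}$, $(M_c)_{ij}=1$ if $i=\omega_j$ and $0$ otherwise; for distinct indices $\omega_1,\dots,\omega_{\rho_r}\in\{1,\dots,p\}$, $(M_r)_{ij}=1$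 if $j=\omega_i$ and $0$ otherwise. $\|\cdot\|_F$ is the Frobenius norm. *)

theory Defs
  imports Complex_Main "Jordan_Normal_Form.VS_Connect"
begin

text \<open>Vectors and matrices are those of \<^theory>\<open>Jordan_Normal_Form.Matrix\<close>, so row and column
  indices start at 0. Eigenvalue sequences are indexed from 1 on, so that \<open>lam k\<close> is the
  \<open>k\<close>-th smallest eigenvalue.\<close>

text \<open>A weighted undirected graph on \<open>{0..<n}\<close> is given by its symmetric nonnegative weight
  matrix \<open>W\<close>; its Laplacian is \<open>D - W\<close> with \<open>D\<close> the diagonal matrix of weighted degrees. Loop
  weights cancel in \<open>D - W\<close>, so the diagonal of \<open>W\<close> is left unconstrained.\<close>

definition undirected_weights :: "nat \<Rightarrow> real mat \<Rightarrow> bool" where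
  "undirected_weights n W \<longleftrightarrow>
     W \<in> carrier_mat n n \<and> W\<^sup>T = W \<and> (\<forall>i<n. \<forall>j<n. 0 \<le> W $$ (i, j))"

definition laplacian :: "real mat \<Rightarrow> real mat" where
  "laplacian W = mat_diag (dim_row W) (\<lambda>i. \<Sum>j<dim_col W. W $$ (i, j)) - W"

definition is_graph_laplacian :: "nat \<Rightarrow> real mat \<Rightarrow> bool" where
  "is_graph_laplacian n L \<longleftrightarrow> (\<exists>W. undirected_weights n W \<and> L = laplacian W)"

text \<open>The constant \<^const>\<open>orthogonal_mat\<close> only asks for pairwise orthogonal nonzero columns, hence
  the explicit orthonormality conditions here.\<close>

definition sorted_eigendecomposition ::
    "nat \<Rightarrow> real mat \<Rightarrow> real mat \<Rightarrow> (nat \<Rightarrow> real) \<Rightarrow> bool" where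
  "sorted_eigendecomposition n L Q lam \<longleftrightarrow>
     Q \<in> carrier_mat n n \<and> Q\<^sup>T * Q = 1\<^sub>m n \<and> Q * Q\<^sup>T = 1\<^sub>m n \<and>
     L = Q * mat_diag n (\<lambda>i. lam (i + 1)) * Q\<^sup>T \<and>
     mono_on {1..n} lam"

definition first_cols :: "nat \<Rightarrow> real mat \<Rightarrow> real mat" where
  "first_cols k Q = mat_of_cols (dim_row Q) (take k (cols Q))"

abbreviation span_mat :: "real mat \<Rightarrow> real vec set" where
  "span_mat A \<equiv> vec_space.col_space (dim_row A) A"

definition low_rank_set :: "real mat \<Rightarrow> real mat \<Rightarrow> real mat set" where
  "low_rank_set P Q =
     {Y \<in> carrier_mat (dim_row P) (dim_row Q).
        set (cols Y) \<subseteq> span_mat P \<and> set (rows Y) \<subseteq> span_mat Q}"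

definition is_row_subsampling :: "nat \<Rightarrow> nat \<Rightarrow> real mat \<Rightarrow> bool" where
  "is_row_subsampling p \<rho> M \<longleftrightarrow>
     (\<exists>\<omega>. inj_on \<omega> {..<\<rho>} \<and> \<omega> ` {..<\<rho>} \<subseteq> {..<p} \<and>
          M = mat \<rho> p (\<lambda>(i, j). if j = \<omega> i then 1 else 0))"

definition is_col_subsampling :: "nat \<Rightarrow> nat \<Rightarrow> real mat \<Rightarrow> bool" where
  "is_col_subsampling n \<rho> M \<longleftrightarrow>
     (\<exists>\<omega>. inj_on \<omega> {..<\<rho>} \<and> \<omega> ` {..<\<rho>} \<subseteq> {..<n} \<and>
          M = mat n \<rho> (\<lambda>(i, j). if i = \<omega> j then 1 else 0))"

definition trace_mat :: "real mat \<Rightarrow> real" where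
  "trace_mat A = sum_list (diag_mat A)"

definition frob_norm :: "real mat \<Rightarrow> real" where
  "frob_norm A = sqrt (\<Sum>i<dim_row A. \<Sum>j<dim_col A. (A $$ (i, j))\<^sup>2)"

end

theory Submission
  imports Defs
begin

text \<open>Since the eigenvalue \<open>\<lambda>\<^bsub>k+1\<^esub>\<close> is positive, the constant vector (which lies in the kernel of a
  Laplacian) is in the span of the first \<open>k\<close> eigenvectors, and subsampling preserves its mean
  square exactly. Testing the restricted isometry inequality on the rank one matrices \<open>x 1\<^sup>T\<close> and
  \<open>1 y\<^sup>T\<close> therefore yields a lower isometry bound for each sampling operator separately.
  The minimiser \<open>U\<close> and the signal \<open>X\<close> agree on the samples, so with the spectral projection
  \<open>\<Pi>\<close> the low frequency error \<open>\<Pi> U - X\<close> has the same sample norm as the high frequency part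
  \<open>U - \<Pi> U\<close>, whose norm is controlled by the energy of \<open>U\<close>, hence by the energy of \<open>X\<close>.
  The argument gives the bound even without the factor 2.\<close>

section \<open>Frobenius norm and energies\<close>

lemma frob_norm_nonneg: "0 \<le> frob_norm A"
  unfolding frob_norm_def by (intro real_sqrt_ge_zero sum_nonneg) auto

lemma frob_norm_sq:
  "(frob_norm A)\<^sup>2 = (\<Sum>i<dim_row A. \<Sum>j<dim_col A. (A $$ (i, j))\<^sup>2)"
  unfolding frob_norm_def by (simp add: sum_nonneg)

lemma frob_norm_transpose: "frob_norm A\<^sup>T = frob_norm A"
proof -
  have "(\<Sum>i<dim_row A\<^sup>T. \<Sum>j<dim_col A\<^sup>T. (A\<^sup>T $$ (i, j))\<^sup>2)
      = (\<Sum>i<dim_col A. \<Sum>j<dim_row A. (A $$ (j, i))\<^sup>2)" by simp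
  also have "\<dots> = (\<Sum>j<dim_row A. \<Sum>i<dim_col A. (A $$ (j, i))\<^sup>2)" by (rule sum.swap)
  finally show ?thesis unfolding frob_norm_def by simp
qed

lemma frob_norm_minus_commute:
  assumes "A \<in> carrier_mat n m" "B \<in> carrier_mat n m"
  shows "frob_norm (A - B) = frob_norm (B - A)"
proof -
  have "((A - B) $$ (i, j))\<^sup>2 = ((B - A) $$ (i, j))\<^sup>2" if "i < n" "j < m" for i j
    using assms that by (simp add: power2_commute[of "A $$ (i, j)"])
  then show ?thesis using assms unfolding frob_norm_def by simp
qed

lemma frob_norm_sq_cols: "(frob_norm A)\<^sup>2 = (\<Sum>j<dim_col A. col A j \<bullet> col A j)"
  unfolding frob_norm_sq
  by (subst sum.swap)
    (simp add: scalar_prod_def power2_eq_square lessThan_atLeast0)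

text \<open>The trace adds the weighted quadratic forms of the columns; exchanging the sums groups
  them by rows, so each weight meets one squared row norm. With unit weights this is the squared
  Frobenius norm, and with the eigenvalues as weights it is the energy in eigencoordinates.\<close>

lemma trace_mat_diag_form:
  assumes A: "A \<in> carrier_mat n m"
  shows "trace_mat (A\<^sup>T * mat_diag n d * A) = (\<Sum>i<n. d i * (\<Sum>j<m. (A $$ (i, j))\<^sup>2))"
proof -
  have eq: "A\<^sup>T * mat_diag n d * A = A\<^sup>T * mat n m (\<lambda>(i, j). d i * A $$ (i, j))"
    using A by (simp add: assoc_mult_mat[of _ m n _ n _ m] mat_diag_mult_left[of _ n m])
  have "trace_mat (A\<^sup>T * mat_diag n d * A) = (\<Sum>j<m. \<Sum>i<n. d i * (A $$ (i, j))\<^sup>2)"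
    unfolding eq trace_mat_def diag_mat_def using A
    by (simp add: sum_list_sum_nth scalar_prod_def lessThan_atLeast0 power2_eq_square
        mult.left_commute)
  then show ?thesis by (subst (asm) sum.swap) (simp add: sum_distrib_left)
qed

lemma frob_norm_sq_trace:
  assumes "A \<in> carrier_mat n m"
  shows "(frob_norm A)\<^sup>2 = trace_mat (A\<^sup>T * A)"
proof -
  have "A\<^sup>T * mat_diag n (\<lambda>_. 1) * A = A\<^sup>T * A" using assms by simp
  with trace_mat_diag_form[OF assms, of "\<lambda>_. 1"] assms show ?thesis
    by (simp add: frob_norm_sq)
qed

text \<open>The factor \<open>Q * Q\<^sup>T\<close> cancels inside the Gram matrix. Norms can
  therefore be computed from the coefficients in the eigenbasis.\<close>

lemma frob_norm_orthogonal_mult: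
  assumes Q: "Q \<in> carrier_mat n n" "Q * Q\<^sup>T = 1\<^sub>m n" and A: "A \<in> carrier_mat n m"
  shows "frob_norm (Q\<^sup>T * A) = frob_norm A"
proof -
  have "(Q\<^sup>T * A)\<^sup>T * (Q\<^sup>T * A) = A\<^sup>T * Q * (Q\<^sup>T * A)"
    using Q(1) A by (simp add: transpose_mult[of _ n n _ m])
  also have "\<dots> = A\<^sup>T * (Q * Q\<^sup>T * A)"
    using Q(1) A by (simp add: assoc_mult_mat[of _ m n _ n _ m] assoc_mult_mat[of _ n n _ n _ m])
  also have "\<dots> = A\<^sup>T * A" using Q A by simp
  finally have "(frob_norm (Q\<^sup>T * A))\<^sup>2 = (frob_norm A)\<^sup>2"
    using frob_norm_sq_trace[of "Q\<^sup>T * A" n m] frob_norm_sq_trace[OF A] Q A by simp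
  then show ?thesis using frob_norm_nonneg power2_eq_iff_nonneg by blast
qed

section \<open>Subsampling\<close>

lemma row_subsampling_carrier: "is_row_subsampling n \<rho> M \<Longrightarrow> M \<in> carrier_mat \<rho> n"
  by (auto simp: is_row_subsampling_def)

text \<open>Lets the sampling of the column graph be treated by the same lemmas as that of the row
  graph.\<close>

lemma is_row_subsampling_transpose:
  "is_col_subsampling n \<rho> M \<Longrightarrow> is_row_subsampling n \<rho> M\<^sup>T"
  unfolding is_col_subsampling_def is_row_subsampling_def
  by (elim exE conjE, rule exI, intro conjI, assumption, assumption) (auto intro!: eq_matI)

lemma row_subsampling_index:
  assumes "\<omega> ` {..<\<rho>} \<subseteq> {..<n}" "E \<in> carrier_mat n m" "i < \<rho>" "j < m"
  shows "(mat \<rho> n (\<lambda>(i, j). if j = \<omega> i then 1 else 0) * E) $$ (i, j) = (E $$ (\<omega> i, j) :: real)"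
proof -
  have "\<omega> i < n" using assms by auto
  then show ?thesis using assms
    by (simp add: scalar_prod_def if_distrib[of "\<lambda>c. c * _"] sum.delta cong: if_cong)
qed

text \<open>By injectivity of \<open>\<omega>\<close>, the rows of \<open>M * E\<close> are distinct
  rows of \<open>E\<close>, so the squares on the left form a partial sum of those on the
  right.\<close>

lemma row_subsampling_contraction:
  assumes "is_row_subsampling n \<rho> M" and E: "E \<in> carrier_mat n m"
  shows "(frob_norm (M * E))\<^sup>2 \<le> (frob_norm E)\<^sup>2"
proof -
  from assms obtain \<omega> where inj: "inj_on \<omega> {..<\<rho>}" and im: "\<omega> ` {..<\<rho>} \<subseteq> {..<n}"
    and M: "M = mat \<rho> n (\<lambda>(i, j). if j = \<omega> i then 1 else 0)"
    unfolding is_row_subsampling_def by blast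
  have "(frob_norm (M * E))\<^sup>2 = (\<Sum>i<\<rho>. \<Sum>j<m. ((M * E) $$ (i, j))\<^sup>2)"
    unfolding frob_norm_sq using M E by simp
  also have "\<dots> = (\<Sum>i<\<rho>. \<Sum>j<m. (E $$ (\<omega> i, j))\<^sup>2)"
    unfolding M using row_subsampling_index[OF im E] by simp
  also have "\<dots> = (\<Sum>i\<in>\<omega> ` {..<\<rho>}. \<Sum>j<m. (E $$ (i, j))\<^sup>2)"
    by (simp add: sum.reindex[OF inj])
  also have "\<dots> \<le> (\<Sum>i<n. \<Sum>j<m. (E $$ (i, j))\<^sup>2)"
    using im by (intro sum_mono2) (auto intro: sum_nonneg)
  finally show ?thesis using E by (simp add: frob_norm_sq)
qed

section \<open>Spectral projections\<close>

lemma first_cols_eq: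
  assumes "Q \<in> carrier_mat n n" "k \<le> n"
  shows "first_cols k Q = mat n k (\<lambda>(i, j). Q $$ (i, j))"
  using assms unfolding first_cols_def
  by (auto intro!: eq_matI simp: mat_of_cols_def min_def)

lemma first_cols_carrier:
  assumes "Q \<in> carrier_mat n n" "k \<le> n"
  shows "first_cols k Q \<in> carrier_mat n k"
  using assms by (simp add: first_cols_eq)

text \<open>Diagonalises the spectral projection in the same basis as the Laplacian, with a 0/1
  diagonal that cuts off after the first \<open>k\<close> coefficients.\<close>

lemma first_cols_projection_eq:
  assumes Q: "Q \<in> carrier_mat n n" and k: "k \<le> n"
  shows "first_cols k Q * (first_cols k Q)\<^sup>T
    = Q * mat_diag n (\<lambda>i. if i < k then 1 else 0) * Q\<^sup>T" (is "?L = ?R")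
proof (rule eq_matI)
  fix i j assume "i < dim_row ?R" "j < dim_col ?R"
  then have ij: "i < n" "j < n" using Q by auto
  have "?R $$ (i, j) = (\<Sum>l<n. (if l < k then Q $$ (i, l) * Q $$ (j, l) else 0))"
    unfolding mat_diag_mult_right[OF Q] using ij Q
    by (simp add: scalar_prod_def lessThan_atLeast0)
      (intro sum.cong, auto)
  also have "\<dots> = (\<Sum>l<k. Q $$ (i, l) * Q $$ (j, l))"
    using k by (intro sum.mono_neutral_cong_right) auto
  finally show "?L $$ (i, j) = ?R $$ (i, j)"
    unfolding first_cols_eq[OF Q k] using ij by (simp add: scalar_prod_def lessThan_atLeast0)
qed (use assms in \<open>auto simp: first_cols_eq\<close>)

lemma first_cols_orthonormal:
  assumes Q: "Q \<in> carrier_mat n n" "Q\<^sup>T * Q = 1\<^sub>m n" and k: "k \<le> n"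
  shows "(first_cols k Q)\<^sup>T * first_cols k Q = 1\<^sub>m k"
proof (rule eq_matI)
  fix i j assume "i < dim_row (1\<^sub>m k :: real mat)" "j < dim_col (1\<^sub>m k :: real mat)"
  then have ij: "i < k" "j < k" by auto
  have "((first_cols k Q)\<^sup>T * first_cols k Q) $$ (i, j) = (Q\<^sup>T * Q) $$ (i, j)"
    unfolding first_cols_eq[OF Q(1) k] using ij k Q(1) by (simp add: scalar_prod_def)
  then show "((first_cols k Q)\<^sup>T * first_cols k Q) $$ (i, j) = 1\<^sub>m k $$ (i, j)"
    using ij k Q by simp
qed (use assms in \<open>auto simp: first_cols_eq\<close>)

text \<open>Write \<open>F\<close> for the first \<open>k\<close> columns. Orthonormality makes
  \<open>F * F\<^sup>T\<close> fix every \<open>F *\<^sub>v x\<close>; conversely a fixed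
  \<open>y\<close> is the image of its coefficient vector \<open>F\<^sup>T *\<^sub>v y\<close>. Span
  membership thus becomes an equation.\<close>

lemma mem_span_first_cols_iff:
  assumes Q: "Q \<in> carrier_mat n n" "Q\<^sup>T * Q = 1\<^sub>m n" and k: "k \<le> n"
  shows "y \<in> span_mat (first_cols k Q) \<longleftrightarrow>
    y \<in> carrier_vec n \<and> (first_cols k Q * (first_cols k Q)\<^sup>T) *\<^sub>v y = y"
proof -
  let ?F = "first_cols k Q"
  have F: "?F \<in> carrier_mat n k" using Q k by (rule_tac first_cols_carrier)
  have FT: "?F\<^sup>T \<in> carrier_mat k n" using F by simp
  have sp: "span_mat ?F = {y \<in> carrier_vec n. \<exists>x\<in>carrier_vec k. ?F *\<^sub>v x = y}"
    using vec_space.col_space_eq[of ?F n k] F by auto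
  show ?thesis
  proof
    assume "y \<in> span_mat ?F"
    then obtain x where x: "x \<in> carrier_vec k" "?F *\<^sub>v x = y" and y: "y \<in> carrier_vec n"
      unfolding sp by auto
    have "(?F * ?F\<^sup>T) *\<^sub>v y = ?F *\<^sub>v (?F\<^sup>T *\<^sub>v (?F *\<^sub>v x))"
      using F FT y x(2) by (simp add: assoc_mult_mat_vec[of _ n k _ n])
    also have "?F\<^sup>T *\<^sub>v (?F *\<^sub>v x) = (?F\<^sup>T * ?F) *\<^sub>v x"
      using F FT x by (simp add: assoc_mult_mat_vec[of _ k n _ k])
    also have "\<dots> = x" using first_cols_orthonormal[OF Q k] x by simp
    finally show "y \<in> carrier_vec n \<and> (?F * ?F\<^sup>T) *\<^sub>v y = y" using x y by simp
  next
    assume "y \<in> carrier_vec n \<and> (?F * ?F\<^sup>T) *\<^sub>v y = y"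
    then have y: "y \<in> carrier_vec n" and eq: "(?F * ?F\<^sup>T) *\<^sub>v y = y" by auto
    have "?F *\<^sub>v (?F\<^sup>T *\<^sub>v y) = y"
      using eq assoc_mult_mat_vec[OF F FT y] by simp
    moreover have "?F\<^sup>T *\<^sub>v y \<in> carrier_vec k" using FT y by auto
    ultimately show "y \<in> span_mat ?F" unfolding sp using y by auto
  qed
qed

lemma cols_subset_span_first_cols_iff:
  assumes Q: "Q \<in> carrier_mat n n" "Q\<^sup>T * Q = 1\<^sub>m n" and k: "k \<le> n"
    and X: "X \<in> carrier_mat n m"
  shows "set (cols X) \<subseteq> span_mat (first_cols k Q) \<longleftrightarrow>
    first_cols k Q * (first_cols k Q)\<^sup>T * X = X"
proof -
  let ?R = "first_cols k Q * (first_cols k Q)\<^sup>T"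
  have R: "?R \<in> carrier_mat n n" using first_cols_carrier[OF Q(1) k] by auto
  have c: "col (?R * X) j = ?R *\<^sub>v col X j" if "j < m" for j
    using col_mult2[OF R X that] .
  have "set (cols X) \<subseteq> span_mat (first_cols k Q) \<longleftrightarrow> (\<forall>j<m. ?R *\<^sub>v col X j = col X j)"
  proof -
    have "set (cols X) = col X ` {..<m}" using X by (auto simp: cols_def)
    moreover have "col X j \<in> carrier_vec n" for j
      by (rule carrier_vecI) (use X in simp)
    ultimately show ?thesis by (simp add: image_subset_iff mem_span_first_cols_iff[OF Q k] Ball_def)
  qed
  also have "\<dots> \<longleftrightarrow> ?R * X = X"
  proof
    assume "\<forall>j<m. ?R *\<^sub>v col X j = col X j"
    then show "?R * X = X" using X R c by (intro mat_col_eqI) auto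
  next
    assume "?R * X = X"
    then show "\<forall>j<m. ?R *\<^sub>v col X j = col X j" using c by auto
  qed
  finally show ?thesis .
qed

section \<open>Graph Laplacians\<close>

text \<open>Each diagonal degree is the corresponding row sum of \<open>W\<close>, so all row sums
  of \<open>D - W\<close> vanish.\<close>

lemma laplacian_mult_ones:
  assumes "is_graph_laplacian n L"
  shows "L *\<^sub>v vec n (\<lambda>_. 1) = 0\<^sub>v n"
proof -
  from assms obtain W where W: "W \<in> carrier_mat n n" and L: "L = laplacian W"
    unfolding is_graph_laplacian_def undirected_weights_def by auto
  show ?thesis
    unfolding L laplacian_def using W
    by (auto intro!: eq_vecI simp: scalar_prod_def mat_diag_def sum_subtractf lessThan_atLeast0)
qed

text \<open>Twice the quadratic form is the sum of the nonnegative terms W_ij (v_i - v_j)^2.\<close>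

lemma laplacian_psd:
  assumes "is_graph_laplacian n L" and v: "v \<in> carrier_vec n"
  shows "0 \<le> v \<bullet> (L *\<^sub>v v)"
proof -
  from assms obtain W where W: "W \<in> carrier_mat n n" "W\<^sup>T = W"
    and nn: "\<And>i j. i < n \<Longrightarrow> j < n \<Longrightarrow> 0 \<le> W $$ (i, j)" and L: "L = laplacian W"
    unfolding is_graph_laplacian_def undirected_weights_def by auto
  have sym: "W $$ (i, j) = W $$ (j, i)" if "i < n" "j < n" for i j
    using W that by (metis carrier_matD index_transpose_mat(1))
  let ?d = "\<Sum>i<n. \<Sum>j<n. W $$ (i, j) * (v $ i)\<^sup>2"
  let ?x = "\<Sum>i<n. \<Sum>j<n. W $$ (i, j) * (v $ i * v $ j)"
  have Lv: "(L *\<^sub>v v) $ i = (\<Sum>j<n. W $$ (i, j)) * v $ i - (\<Sum>j<n. W $$ (i, j) * v $ j)"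
    if "i < n" for i
    unfolding L laplacian_def using W v that
    by (simp add: scalar_prod_def mat_diag_def left_diff_distrib sum_subtractf
        if_distrib[of "\<lambda>c. c * _"] lessThan_atLeast0 cong: if_cong)
  have "v \<bullet> (L *\<^sub>v v) = (\<Sum>i<n. v $ i * (L *\<^sub>v v) $ i)"
    using L W v by (simp add: scalar_prod_def laplacian_def lessThan_atLeast0)
  also have "\<dots> = (\<Sum>i<n. (\<Sum>j<n. W $$ (i, j) * (v $ i)\<^sup>2) - (\<Sum>j<n. W $$ (i, j) * (v $ i * v $ j)))"
    by (intro sum.cong refl, simp add: Lv)
      (simp add: right_diff_distrib sum_distrib_left sum_distrib_right power2_eq_square mult_ac)
  also have "\<dots> = ?d - ?x" by (simp add: sum_subtractf)
  finally have 1: "v \<bullet> (L *\<^sub>v v) = ?d - ?x" .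
  \<comment> \<open>Symmetry of the weights enters here: both squares in the expansion of (v_i -
    v_j)^2 contribute the same degree sum \<open>?d\<close>.\<close>
  have d': "?d = (\<Sum>i<n. \<Sum>j<n. W $$ (i, j) * (v $ j)\<^sup>2)"
    by (subst sum.swap) (intro sum.cong refl, simp add: sym)
  have "0 \<le> (\<Sum>i<n. \<Sum>j<n. W $$ (i, j) * (v $ i - v $ j)\<^sup>2)"
    by (intro sum_nonneg mult_nonneg_nonneg nn) auto
  also have "\<dots> = ?d + (\<Sum>i<n. \<Sum>j<n. W $$ (i, j) * (v $ j)\<^sup>2) - 2 * ?x"
    by (simp add: power2_diff algebra_simps sum.distrib sum_subtractf sum_distrib_left)
  finally show ?thesis using 1 d' by simp
qed

lemma eigendecomposition_eigenvector:
  assumes dec: "sorted_eigendecomposition n L Q lam" and i: "i < n"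
  shows "L *\<^sub>v col Q i = lam (i + 1) \<cdot>\<^sub>v col Q i"
proof -
  from dec have Q: "Q \<in> carrier_mat n n" and o: "Q\<^sup>T * Q = 1\<^sub>m n"
    and L: "L = Q * mat_diag n (\<lambda>i. lam (i + 1)) * Q\<^sup>T"
    unfolding sorted_eigendecomposition_def by auto
  let ?D = "mat_diag n (\<lambda>i. lam (i + 1))"
  have "L * Q = Q * ?D * (Q\<^sup>T * Q)"
    unfolding L using Q by (intro assoc_mult_mat[of _ n n _ n _ n]) auto
  then have LQ: "L * Q = Q * ?D"
    using Q o right_mult_one_mat[of "Q * ?D" n n] by (simp add: mult_carrier_mat[of _ n n _ n])
  have Lc: "L \<in> carrier_mat n n" using L Q by auto
  have "L *\<^sub>v col Q i = col (L * Q) i" using col_mult2[OF Lc Q i] by simp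
  also have "\<dots> = lam (i + 1) \<cdot>\<^sub>v col Q i"
    unfolding LQ mat_diag_mult_right[OF Q] using Q i by (auto intro!: eq_vecI)
  finally show ?thesis .
qed

text \<open>The eigenvalue is the value of the positive semidefinite form at the unit eigenvector
  \<open>col Q i\<close>.\<close>

lemma laplacian_eigenvalue_nonneg:
  assumes "is_graph_laplacian n L" and dec: "sorted_eigendecomposition n L Q lam" and i: "i < n"
  shows "0 \<le> lam (i + 1)"
proof -
  from dec have Q: "Q \<in> carrier_mat n n" and o: "Q\<^sup>T * Q = 1\<^sub>m n"
    unfolding sorted_eigendecomposition_def by auto
  have c: "col Q i \<in> carrier_vec n" using Q i by auto
  have "(Q\<^sup>T * Q) $$ (i, i) = col Q i \<bullet> col Q i" using Q i by simp
  then have "col Q i \<bullet> col Q i = 1" using o i by simp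
  with laplacian_psd[OF assms(1) c] show ?thesis
    using c eigendecomposition_eigenvector[OF dec i] by simp
qed

text \<open>The constant vector is in the kernel of \<open>L\<close>, so its eigencoordinates
  \<open>a\<close> are killed by the diagonal matrix of eigenvalues. A coordinate can survive only
  where the eigenvalue is zero, hence only among the first \<open>k\<close>.\<close>

lemma ones_mem_span_first_cols:
  assumes lap: "is_graph_laplacian n L" and dec: "sorted_eigendecomposition n L Q lam"
    and k: "k < n" and pos: "0 < lam (k + 1)"
  shows "vec n (\<lambda>_. 1) \<in> span_mat (first_cols k Q)"
proof -
  from dec have Q: "Q \<in> carrier_mat n n" and o: "Q\<^sup>T * Q = 1\<^sub>m n" and o': "Q * Q\<^sup>T = 1\<^sub>m n"
    and L: "L = Q * mat_diag n (\<lambda>i. lam (i + 1)) * Q\<^sup>T"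
    and mono: "mono_on {1..n} lam"
    unfolding sorted_eigendecomposition_def by auto
  let ?e = "vec n (\<lambda>_. 1) :: real vec"
  let ?D = "mat_diag n (\<lambda>i. if i < k then 1 else 0) :: real mat"
  let ?\<Lambda> = "mat_diag n (\<lambda>i. lam (i + 1))"
  define a where "a = Q\<^sup>T *\<^sub>v ?e"
  have a: "a \<in> carrier_vec n" using Q unfolding a_def by auto
  have diag: "(mat_diag n d *\<^sub>v a) $ i = d i * a $ i" if "i < n" for d i
    using a that by (simp add: mat_diag_def scalar_prod_def if_distrib[of "\<lambda>c. c * _"] cong: if_cong)
  have "Q\<^sup>T * L = (Q\<^sup>T * Q) * (?\<Lambda> * Q\<^sup>T)"
    unfolding L using Q
    by (simp add: assoc_mult_mat[of _ n n _ n _ n] mult_carrier_mat[of _ n n _ n])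
  then have QL: "Q\<^sup>T * L = ?\<Lambda> * Q\<^sup>T"
    using o Q by (simp add: left_mult_one_mat[of _ n n] mult_carrier_mat[of _ n n _ n])
  have Lc: "L \<in> carrier_mat n n" using L Q by auto
  have "?\<Lambda> *\<^sub>v a = (?\<Lambda> * Q\<^sup>T) *\<^sub>v ?e"
    unfolding a_def using Q by (simp add: assoc_mult_mat_vec[of _ n n _ n])
  also have "\<dots> = Q\<^sup>T *\<^sub>v (L *\<^sub>v ?e)"
    unfolding QL[symmetric] using Q Lc by (simp add: assoc_mult_mat_vec[of _ n n _ n])
  also have "\<dots> = 0\<^sub>v n" using laplacian_mult_ones[OF lap] Q by (auto intro!: eq_vecI)
  finally have z: "?\<Lambda> *\<^sub>v a = 0\<^sub>v n" .
  \<comment> \<open>Coordinates count from 0 and eigenvalues from 1: coordinate \<open>i\<close>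
    belongs to \<open>lam (i + 1)\<close>, which for \<open>k \<le> i\<close> is at least
    \<open>lam (k + 1)\<close>.\<close>
  have zero: "a $ i = 0" if "k \<le> i" "i < n" for i
  proof -
    have "lam (k + 1) \<le> lam (i + 1)" using that by (intro mono_onD[OF mono]) auto
    moreover have "lam (i + 1) * a $ i = 0" using diag[OF that(2)] z that(2) by (metis index_zero_vec(1))
    ultimately show ?thesis using pos by auto
  qed
  have "?D *\<^sub>v a = a" using zero diag a by (intro eq_vecI) (auto simp: mat_diag_def)
  then have "(Q * ?D * Q\<^sup>T) *\<^sub>v ?e = Q *\<^sub>v a"
    using Q by (simp add: assoc_mult_mat_vec[of _ n n _ n] mult_carrier_mat[of _ n n _ n] a_def
        del: assoc_mult_mat)
  also have "\<dots> = (Q * Q\<^sup>T) *\<^sub>v ?e" unfolding a_def using Q by (simp add: assoc_mult_mat_vec[of _ n n _ n])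
  also have "\<dots> = ?e" using o' by simp
  finally show ?thesis
    using mem_span_first_cols_iff[OF Q o] k first_cols_projection_eq[OF Q] by simp
qed

section \<open>Lower isometry bound for one sampling operator\<close>

lemma smult_mem_span_first_cols:
  fixes y :: "real vec"
  assumes Q: "Q \<in> carrier_mat n n" "Q\<^sup>T * Q = 1\<^sub>m n" and k: "k \<le> n"
    and y: "y \<in> span_mat (first_cols k Q)"
  shows "c \<cdot>\<^sub>v y \<in> span_mat (first_cols k Q)"
proof -
  have "first_cols k Q * (first_cols k Q)\<^sup>T \<in> carrier_mat n n"
    using first_cols_carrier[OF Q(1) k] by auto
  then show ?thesis
    using y mult_mat_vec[of "first_cols k Q * (first_cols k Q)\<^sup>T" n n y c]
    by (simp add: mem_span_first_cols_iff[OF Q k])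
qed

text \<open>The two-sided inequality is tested on the rank one matrix x 1^T. All its columns are
  \<open>x\<close>, so its squared norm is \<open>n\<close> times that of \<open>x\<close>, and
  after sampling \<open>\<rho>_c\<close> copies of \<open>M *\<^sub>v x\<close> remain. The column
  counts cancel against the factor \<open>n / \<rho>_c\<close>. The hypothesis \<open>ones\<close>
  makes the rows of the test matrix admissible.\<close>

lemma one_sided_lower_bound:
  assumes P: "P \<in> carrier_mat p p" "P\<^sup>T * P = 1\<^sub>m p" "k_r \<le> p"
    and Q: "Q \<in> carrier_mat n n" "Q\<^sup>T * Q = 1\<^sub>m n" "k_c \<le> n"
    and ones: "vec n (\<lambda>_. 1) \<in> span_mat (first_cols k_c Q)"
    and M: "is_row_subsampling p \<rho>_r M" and N: "is_row_subsampling n \<rho>_c N"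
    and pos: "0 < n" "0 < p" "0 < \<rho>_r" "0 < \<rho>_c"
    and rip: "\<And>Y. Y \<in> low_rank_set (first_cols k_r P) (first_cols k_c Q) \<Longrightarrow>
       \<alpha> * (frob_norm Y)\<^sup>2 \<le> (real n * real p) / (real \<rho>_r * real \<rho>_c) * (frob_norm (M * Y * N\<^sup>T))\<^sup>2"
    and x: "x \<in> span_mat (first_cols k_r P)"
  shows "\<alpha> * real \<rho>_r / real p * (x \<bullet> x) \<le> (M *\<^sub>v x) \<bullet> (M *\<^sub>v x)"
proof -
  have xc: "x \<in> carrier_vec p" using x mem_span_first_cols_iff[OF P] by simp
  define Y where "Y = mat p n (\<lambda>(i, j). x $ i)"
  have Yc: "Y \<in> carrier_mat p n" by (simp add: Y_def)
  have colY: "col Y j = x" if "j < n" for j using that xc by (auto simp: Y_def)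
  have rowY: "row Y i = x $ i \<cdot>\<^sub>v vec n (\<lambda>_. 1)" if "i < p" for i
    using that by (auto simp: Y_def intro!: eq_vecI)
  have "set (cols Y) \<subseteq> {x}" using colY Yc by (auto simp: cols_def)
  moreover have "set (rows Y) \<subseteq> span_mat (first_cols k_c Q)"
    using rowY Yc smult_mem_span_first_cols[OF Q ones] by (auto simp: rows_def)
  ultimately have "Y \<in> low_rank_set (first_cols k_r P) (first_cols k_c Q)"
    unfolding low_rank_set_def
    using x Yc first_cols_carrier[OF P(1,3)] first_cols_carrier[OF Q(1,3)] by auto
  note r = rip[OF this]
  have nY: "(frob_norm Y)\<^sup>2 = real n * (x \<bullet> x)"
    unfolding frob_norm_sq_cols using colY Yc by simp
  have Mc: "M \<in> carrier_mat \<rho>_r p" using row_subsampling_carrier[OF M] .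
  have Nc: "N \<in> carrier_mat \<rho>_c n" using row_subsampling_carrier[OF N] .
  have MYc: "(M * Y)\<^sup>T \<in> carrier_mat n \<rho>_r" using Mc Yc by simp
  from N obtain \<omega> where im: "\<omega> ` {..<\<rho>_c} \<subseteq> {..<n}"
    and Neq: "N = mat \<rho>_c n (\<lambda>(i, j). if j = \<omega> i then 1 else 0)"
    unfolding is_row_subsampling_def by blast
  \<comment> \<open>Column selection is rewritten as row selection on the transpose, where
    \<open>row_subsampling_index\<close> applies.\<close>
  have tr: "M * Y * N\<^sup>T = (N * (M * Y)\<^sup>T)\<^sup>T"
    using transpose_mult[OF Nc MYc] by simp
  have colS: "col (M * Y * N\<^sup>T) j = M *\<^sub>v x" if j: "j < \<rho>_c" for j
  proof (rule eq_vecI)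
    have \<omega>j: "\<omega> j < n" using im j by auto
    fix i assume "i < dim_vec (M *\<^sub>v x)"
    then have i: "i < \<rho>_r" using Mc by simp
    have "col (M * Y * N\<^sup>T) j $ i = (N * (M * Y)\<^sup>T) $$ (j, i)"
      unfolding tr using i j Mc Nc by simp
    also have "\<dots> = (M * Y)\<^sup>T $$ (\<omega> j, i)"
      unfolding Neq by (rule row_subsampling_index[OF im MYc j i])
    also have "\<dots> = (M *\<^sub>v x) $ i" using Mc Yc i \<omega>j colY by simp
    finally show "col (M * Y * N\<^sup>T) j $ i = (M *\<^sub>v x) $ i" .
  qed (use Mc in simp)
  have nS: "(frob_norm (M * Y * N\<^sup>T))\<^sup>2 = real \<rho>_c * ((M *\<^sub>v x) \<bullet> (M *\<^sub>v x))"
    unfolding frob_norm_sq_cols using colS Nc by simp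
  from r pos show ?thesis unfolding nY nS by (simp add: field_simps)
qed

section \<open>Recovery of one factor\<close>

text \<open>With low frequency error \<open>E\<close> and high frequency part \<open>H\<close>, two
  chains are combined: c |E|^2 \<le> |M E|^2 = |M H|^2 \<le> |H|^2, and \<open>lam (k + 1)\<close>
  |H|^2 \<le> energy of \<open>U\<close> \<le> energy of \<open>X\<close> \<le> \<open>lam k\<close>
  |X|^2. Of the Laplacian, only the nonnegative spectrum enters.\<close>

lemma spectral_recovery_bound:
  assumes dec: "sorted_eigendecomposition n L Q lam"
    and nonneg: "\<And>i. i < n \<Longrightarrow> 0 \<le> lam (i + 1)"
    and k: "1 \<le> k" "k < n" and gap: "0 < lam (k + 1)"
    and M: "is_row_subsampling n \<rho> M" and c: "0 < c"
    and lower: "\<And>x. x \<in> span_mat (first_cols k Q) \<Longrightarrow> c * (x \<bullet> x) \<le> (M *\<^sub>v x) \<bullet> (M *\<^sub>v x)"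
    and X: "X \<in> carrier_mat n m" "set (cols X) \<subseteq> span_mat (first_cols k Q)"
    and U: "U \<in> carrier_mat n m" "M * U = M * X"
    and energy: "trace_mat (U\<^sup>T * L * U) \<le> trace_mat (X\<^sup>T * L * X)"
  shows "frob_norm (first_cols k Q * (first_cols k Q)\<^sup>T * U - X)
    \<le> sqrt (1 / c) * sqrt (lam k / lam (k + 1)) * frob_norm X"
proof -
  from dec have Q: "Q \<in> carrier_mat n n" and o: "Q\<^sup>T * Q = 1\<^sub>m n" and o': "Q * Q\<^sup>T = 1\<^sub>m n"
    and L: "L = Q * mat_diag n (\<lambda>i. lam (i + 1)) * Q\<^sup>T"
    and mono: "mono_on {1..n} lam"
    unfolding sorted_eigendecomposition_def by auto
  let ?D = "mat_diag n (\<lambda>i. if i < k then 1 else 0) :: real mat"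
  let ?\<Lambda> = "mat_diag n (\<lambda>i. lam (i + 1))"
  define F where "F = first_cols k Q"
  define R where "R = F * F\<^sup>T"
  have F: "F \<in> carrier_mat n k" unfolding F_def using Q k by (intro first_cols_carrier) auto
  have Rc: "R \<in> carrier_mat n n" using F by (auto simp: R_def)
  have R: "R = Q * ?D * Q\<^sup>T"
    unfolding R_def F_def using Q k by (intro first_cols_projection_eq) auto
  have "Q\<^sup>T * R = (Q\<^sup>T * Q) * (?D * Q\<^sup>T)"
    unfolding R using Q
    by (simp add: assoc_mult_mat[of _ n n _ n _ n] mult_carrier_mat[of _ n n _ n])
  then have QR: "Q\<^sup>T * R = ?D * Q\<^sup>T" using o Q by (simp add: left_mult_one_mat[of _ n n] mult_carrier_mat[of _ n n _ n])
  have RR: "R * R = R"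
  proof -
    have "R * R = F * ((F\<^sup>T * F) * F\<^sup>T)"
      unfolding R_def using F
      by (simp add: assoc_mult_mat[of _ n k _ n _ n] assoc_mult_mat[of _ k n _ k _ n])
    then show ?thesis using first_cols_orthonormal[OF Q o] k F by (simp add: R_def F_def)
  qed
  \<comment> \<open>In eigencoordinates the projection is truncation to the first \<open>k\<close>
    rows.\<close>
  have coeff: "Q\<^sup>T * (R * Z) = mat n m (\<lambda>(i, j). if i < k then (Q\<^sup>T * Z) $$ (i, j) else 0)"
    if Z: "Z \<in> carrier_mat n m" for Z
  proof -
    have "Q\<^sup>T * (R * Z) = ?D * (Q\<^sup>T * Z)"
      using assoc_mult_mat[OF _ Rc Z, of "Q\<^sup>T" n] assoc_mult_mat[of ?D n n "Q\<^sup>T" n Z m] Q Z QR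
      by simp
    then show ?thesis using Q Z by (simp add: mat_diag_mult_left[of _ n m]) (auto intro!: eq_matI)
  qed
  have energy_eq: "trace_mat (Z\<^sup>T * L * Z)
      = (\<Sum>i<n. lam (i + 1) * (\<Sum>j<m. ((Q\<^sup>T * Z) $$ (i, j))\<^sup>2))"
    if Z: "Z \<in> carrier_mat n m" for Z
  proof -
    have "(Q\<^sup>T * Z)\<^sup>T * ?\<Lambda> * (Q\<^sup>T * Z) = Z\<^sup>T * Q * ?\<Lambda> * (Q\<^sup>T * Z)"
      using Q Z by (simp add: transpose_mult[of _ n n _ m])
    also have "\<dots> = Z\<^sup>T * L * Z"
      unfolding L using Q Z
      by (simp add: assoc_mult_mat[of _ m n _ n _ n] assoc_mult_mat[of _ m n _ n _ m]
          assoc_mult_mat[of _ n n _ n _ n] assoc_mult_mat[of _ n n _ n _ m]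
          mult_carrier_mat[of _ n n _ n] mult_carrier_mat[of _ n n _ m])
    finally show ?thesis using trace_mat_diag_form[of "Q\<^sup>T * Z" n m "\<lambda>i. lam (i + 1)"] Q Z by simp
  qed
  have frob_eq: "(frob_norm Z)\<^sup>2 = (\<Sum>i<n. \<Sum>j<m. ((Q\<^sup>T * Z) $$ (i, j))\<^sup>2)"
    if Z: "Z \<in> carrier_mat n m" for Z
    using frob_norm_orthogonal_mult[OF Q o' Z] frob_norm_sq[of "Q\<^sup>T * Z"] Q Z by simp
  \<comment> \<open>\<open>s Z i\<close> is the squared norm of the \<open>i\<close>-th
    eigencoefficient row: the norm is the plain sum over \<open>i\<close>, the energy the sum
    weighted by the eigenvalues.\<close>
  define s where "s Z i = (\<Sum>j<m. ((Q\<^sup>T * Z) $$ (i, j))\<^sup>2)" for Z i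
  have s0: "0 \<le> s Z i" for Z i unfolding s_def by (intro sum_nonneg) auto
  have RX: "R * X = X"
    using cols_subset_span_first_cols_iff[OF Q o _ X(1)] X k by (simp add: R_def F_def)
  define E where "E = R * U - X"
  define H where "H = U - R * U"
  have RU: "R * U \<in> carrier_mat n m" using Rc U by auto
  have Ec: "E \<in> carrier_mat n m" using X unfolding E_def by auto
  have Hc: "H \<in> carrier_mat n m" using RU unfolding H_def by (intro minus_carrier_mat)
  have "R * E = R * (R * U) - R * X"
    unfolding E_def using Rc RU X by (intro mult_minus_distrib_mat)
  also have "R * (R * U) = R * U" using assoc_mult_mat[OF Rc Rc U(1)] RR by simp
  finally have "R * E = E" using RX by (simp add: E_def)
  \<comment> \<open>The error stays in the low frequency space, so \<open>lower\<close> applies to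
    each of its columns.\<close>
  then have spanE: "set (cols E) \<subseteq> span_mat F"
    using cols_subset_span_first_cols_iff[OF Q o _ Ec] k by (simp add: R_def F_def)
  have Mc: "M \<in> carrier_mat \<rho> n" using row_subsampling_carrier[OF M] .
  have "c * (frob_norm E)\<^sup>2 \<le> (frob_norm (M * E))\<^sup>2"
    unfolding frob_norm_sq_cols sum_distrib_left
  proof (rule order_trans[OF sum_mono[where g = "\<lambda>j. (M *\<^sub>v col E j) \<bullet> (M *\<^sub>v col E j)"]])
    fix j assume "j \<in> {..<dim_col E}"
    then have "col E j \<in> span_mat F" using spanE by (auto simp: cols_def)
    then show "c * (col E j \<bullet> col E j) \<le> (M *\<^sub>v col E j) \<bullet> (M *\<^sub>v col E j)"
      using lower by (simp add: F_def)
  next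
    have "col (M * E) j = M *\<^sub>v col E j" if "j < m" for j using col_mult2[OF Mc Ec that] .
    then show "(\<Sum>j<dim_col E. (M *\<^sub>v col E j) \<bullet> (M *\<^sub>v col E j))
        \<le> (\<Sum>j<dim_col (M * E). col (M * E) j \<bullet> col (M * E) j)"
      using Ec by (intro eq_refl sum.cong) auto
  qed
  \<comment> \<open>Since \<open>M * U = M * X\<close>, the sampled matrices \<open>M * E\<close>
    and \<open>M * H\<close> differ only by sign.\<close>
  also have "(frob_norm (M * E))\<^sup>2 = (frob_norm (M * H))\<^sup>2"
  proof -
    have 1: "M * E = M * (R * U) - M * U"
      unfolding E_def U(2) using Mc RU X by (intro mult_minus_distrib_mat)
    have 2: "M * H = M * U - M * (R * U)"
      unfolding H_def using Mc RU U by (intro mult_minus_distrib_mat)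
    show ?thesis unfolding 1 2
      using Mc U(1) RU by (subst frob_norm_minus_commute[of _ \<rho> m]) (auto intro: mult_carrier_mat)
  qed
  also have "\<dots> \<le> (frob_norm H)\<^sup>2" by (rule row_subsampling_contraction[OF M Hc])
  finally have EH: "c * (frob_norm E)\<^sup>2 \<le> (frob_norm H)\<^sup>2" .
  have QH: "Q\<^sup>T * H = Q\<^sup>T * U - Q\<^sup>T * (R * U)"
    unfolding H_def using Q RU U by (intro mult_minus_distrib_mat) auto
  have sH: "s H i = (if i < k then 0 else s U i)" if "i < n" for i
    unfolding s_def QH coeff[OF U(1)] using that Q U(1)
    by (auto intro!: sum.cong simp del: index_mult_mat(1))
  have sX: "s X i = 0" if "k \<le> i" "i < n" for i
  proof -
    have "(Q\<^sup>T * X) $$ (i, j) = 0" if "j < m" for j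
      by (subst coeff[OF X(1), unfolded RX]) (use that \<open>k \<le> i\<close> \<open>i < n\<close> in simp)
    then show ?thesis unfolding s_def by (simp del: index_mult_mat(1))
  qed
  have "lam (k + 1) * (frob_norm H)\<^sup>2 = (\<Sum>i<n. lam (k + 1) * s H i)"
    unfolding frob_eq[OF Hc] s_def by (simp add: sum_distrib_left)
  \<comment> \<open>\<open>H\<close> carries exactly the coefficients of \<open>U\<close> with
    \<open>i \<ge> k\<close>, whose eigenvalues are at least \<open>lam (k + 1)\<close>; the
    remaining energy of \<open>U\<close> is nonnegative and is added.\<close>
  also have "\<dots> \<le> (\<Sum>i<n. lam (i + 1) * s U i)"
  proof (intro sum_mono)
    fix i assume "i \<in> {..<n}"
    then have i: "i < n" by simp
    show "lam (k + 1) * s H i \<le> lam (i + 1) * s U i"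
    proof (cases "i < k")
      case True
      then show ?thesis using sH[OF i] nonneg[OF i] s0 by simp
    next
      case False
      then have "lam (k + 1) \<le> lam (i + 1)" using i by (intro mono_onD[OF mono]) auto
      then show ?thesis using sH[OF i] False s0 by (simp add: mult_right_mono)
    qed
  qed
  also have "\<dots> \<le> (\<Sum>i<n. lam (i + 1) * s X i)"
    using energy unfolding energy_eq[OF U(1)] energy_eq[OF X(1)] s_def .
  \<comment> \<open>\<open>X\<close> has coefficients only for \<open>i < k\<close>, where the
    eigenvalue \<open>lam (i + 1)\<close> is at most \<open>lam k\<close>.\<close>
  also have "\<dots> \<le> (\<Sum>i<n. lam k * s X i)"
  proof (intro sum_mono)
    fix i assume "i \<in> {..<n}"
    then have i: "i < n" by simp
    show "lam (i + 1) * s X i \<le> lam k * s X i"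
    proof (cases "i < k")
      case True
      then have "lam (i + 1) \<le> lam k" using k by (intro mono_onD[OF mono]) auto
      then show ?thesis using s0 by (simp add: mult_right_mono)
    next
      case False
      then show ?thesis using sX i by simp
    qed
  qed
  also have "\<dots> = lam k * (frob_norm X)\<^sup>2"
    unfolding frob_eq[OF X(1)] s_def by (simp add: sum_distrib_left)
  finally have HX: "lam (k + 1) * (frob_norm H)\<^sup>2 \<le> lam k * (frob_norm X)\<^sup>2" .
  have "c * lam (k + 1) * (frob_norm E)\<^sup>2 \<le> lam k * (frob_norm X)\<^sup>2"
    using order_trans[OF mult_left_mono[OF EH, of "lam (k + 1)"] HX] gap by (simp add: mult_ac)
  then have "(frob_norm E)\<^sup>2 \<le> 1 / c * (lam k / lam (k + 1)) * (frob_norm X)\<^sup>2"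
    using c gap by (simp add: field_simps)
  then have "frob_norm E \<le> sqrt (1 / c * (lam k / lam (k + 1)) * (frob_norm X)\<^sup>2)"
    by (rule real_le_rsqrt)
  then have "frob_norm E \<le> sqrt (1 / c) * sqrt (lam k / lam (k + 1)) * frob_norm X"
    using frob_norm_nonneg[of X] by (simp only: real_sqrt_mult real_sqrt_abs abs_of_nonneg)
  then show ?thesis unfolding E_def R_def F_def .
qed

text \<open>Formulated for one factor with two row samplers, so that exchanging the roles of the two
  graphs yields the bound for the other factor.\<close>

lemma subsampled_recovery_bound:
  assumes lap: "is_graph_laplacian p L" "is_graph_laplacian n L'"
    and dec: "sorted_eigendecomposition p L P lam" "sorted_eigendecomposition n L' Q lam'"
    and k: "1 \<le> k_r" "k_r < p" "k_c < n"
    and gap: "0 < lam (k_r + 1)" "0 < lam' (k_c + 1)"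
    and M: "is_row_subsampling p \<rho>_r M" and N: "is_row_subsampling n \<rho>_c N"
    and pos: "1 \<le> \<rho>_r" "1 \<le> \<rho>_c" and \<delta>: "\<delta> < 1"
    and rip: "\<And>Y. Y \<in> low_rank_set (first_cols k_r P) (first_cols k_c Q) \<Longrightarrow>
       (1 - \<delta>) * (frob_norm Y)\<^sup>2
         \<le> (real n * real p) / (real \<rho>_r * real \<rho>_c) * (frob_norm (M * Y * N\<^sup>T))\<^sup>2"
    and X: "X \<in> carrier_mat p m" "set (cols X) \<subseteq> span_mat (first_cols k_r P)"
    and min: "is_arg_min (\<lambda>U. trace_mat (U\<^sup>T * L * U)) (\<lambda>U. U \<in> carrier_mat p m \<and> M * U = M * X) U"
  shows "frob_norm (first_cols k_r P * (first_cols k_r P)\<^sup>T * U - X)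
    \<le> sqrt (2 * real p / (real \<rho>_r * (1 - \<delta>))) * sqrt (lam k_r / lam (k_r + 1)) * frob_norm X"
proof -
  \<comment> \<open>The constant given by \<open>one_sided_lower_bound\<close> for
    \<open>\<alpha> = 1 - \<delta>\<close>.\<close>
  let ?c = "(1 - \<delta>) * real \<rho>_r / real p"
  have c: "0 < ?c" using pos \<delta> k by simp
  have P: "P \<in> carrier_mat p p" "P\<^sup>T * P = 1\<^sub>m p" and Q: "Q \<in> carrier_mat n n" "Q\<^sup>T * Q = 1\<^sub>m n"
    using dec unfolding sorted_eigendecomposition_def by auto
  \<comment> \<open>\<open>X\<close> is itself feasible, so the minimiser has no larger
    energy.\<close>
  have U: "U \<in> carrier_mat p m" "M * U = M * X"
    and energy: "trace_mat (U\<^sup>T * L * U) \<le> trace_mat (X\<^sup>T * L * X)"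
    using min X(1) unfolding is_arg_min_def by (auto simp: not_less)
  have "frob_norm (first_cols k_r P * (first_cols k_r P)\<^sup>T * U - X)
    \<le> sqrt (1 / ?c) * sqrt (lam k_r / lam (k_r + 1)) * frob_norm X"
  proof (rule spectral_recovery_bound[OF dec(1) _ k(1,2) gap(1) M c _ X U energy])
    show "0 \<le> lam (i + 1)" if "i < p" for i
      using laplacian_eigenvalue_nonneg[OF lap(1) dec(1) that] .
    show "?c * (x \<bullet> x) \<le> (M *\<^sub>v x) \<bullet> (M *\<^sub>v x)" if "x \<in> span_mat (first_cols k_r P)" for x
      by (rule one_sided_lower_bound[OF P _ Q _
            ones_mem_span_first_cols[OF lap(2) dec(2) k(3) gap(2)] M N _ _ _ _ rip that])
        (use k pos in auto)
  qed
  \<comment> \<open>The value \<open>1 / ?c\<close> is half of the target constant under the first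
    root.\<close>
  also have "\<dots> \<le> sqrt (2 * real p / (real \<rho>_r * (1 - \<delta>))) * sqrt (lam k_r / lam (k_r + 1)) * frob_norm X"
  proof (intro mult_right_mono real_sqrt_le_mono frob_norm_nonneg)
    show "1 / ?c \<le> 2 * real p / (real \<rho>_r * (1 - \<delta>))"
      using pos \<delta> k by (simp add: field_simps)
    have "0 \<le> lam k_r" using laplacian_eigenvalue_nonneg[OF lap(1) dec(1), of "k_r - 1"] k by simp
    then show "0 \<le> sqrt (lam k_r / lam (k_r + 1))" using gap by simp
  qed
  finally show ?thesis .
qed

theorem theorem5:
  fixes n p k k_c k_r \<rho>_c \<rho>_r :: nat
    and L_c L_r Q P M_c M_r Ubar Vbar Utilde Vtilde Ustar Vstar Ubarstar Vbarstar :: "real mat"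
    and lam_c lam_r :: "nat \<Rightarrow> real"
    and \<delta> :: real
  assumes "is_graph_laplacian n L_c" and "is_graph_laplacian p L_r"
    and "sorted_eigendecomposition n L_c Q lam_c"
    and "sorted_eigendecomposition p L_r P lam_r"
    and "1 \<le> k_c" "k_c < n" and "1 \<le> k_r" "k_r < p" and "1 \<le> k"
    and "0 < \<delta>" "\<delta> < 1"
    and "1 \<le> \<rho>_r" "is_row_subsampling p \<rho>_r M_r"
    and "1 \<le> \<rho>_c" "is_col_subsampling n \<rho>_c M_c"
    and "\<forall>Y \<in> low_rank_set (first_cols k_r P) (first_cols k_c Q).
           (1 - \<delta>) * (frob_norm Y)\<^sup>2
             \<le> (real n * real p) / (real \<rho>_r * real \<rho>_c) * (frob_norm (M_r * Y * M_c))\<^sup>2 \<and>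
           (real n * real p) / (real \<rho>_r * real \<rho>_c) * (frob_norm (M_r * Y * M_c))\<^sup>2
             \<le> (1 + \<delta>) * (frob_norm Y)\<^sup>2"
    and "0 < lam_r (k_r + 1)" and "0 < lam_c (k_c + 1)"
    and "Ubar \<in> carrier_mat p k" "set (cols Ubar) \<subseteq> span_mat (first_cols k_r P)"
    and "Vbar \<in> carrier_mat n k" "set (cols Vbar) \<subseteq> span_mat (first_cols k_c Q)"
    and "Utilde = M_r * Ubar" and "Vtilde = M_c\<^sup>T * Vbar"
    and "is_arg_min (\<lambda>U. trace_mat (U\<^sup>T * L_r * U))
           (\<lambda>U. U \<in> carrier_mat p k \<and> M_r * U = Utilde) Ustar"
    and "is_arg_min (\<lambda>V. trace_mat (V\<^sup>T * L_c * V))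
           (\<lambda>V. V \<in> carrier_mat n k \<and> M_c\<^sup>T * V = Vtilde) Vstar"
    and "Ubarstar = first_cols k_r P * (first_cols k_r P)\<^sup>T * Ustar"
    and "Vbarstar = first_cols k_c Q * (first_cols k_c Q)\<^sup>T * Vstar"
  shows "frob_norm (Ubarstar - Ubar)
           \<le> sqrt (2 * real p / (real \<rho>_r * (1 - \<delta>))) * sqrt (lam_r k_r / lam_r (k_r + 1))
              * frob_norm Ubar
         \<and> frob_norm (Vbarstar - Vbar)
           \<le> sqrt (2 * real n / (real \<rho>_c * (1 - \<delta>))) * sqrt (lam_c k_c / lam_c (k_c + 1))
              * frob_norm Vbar"
proof -
  note a = assms
  have N: "is_row_subsampling n \<rho>_c M_c\<^sup>T" using a(15) by (rule is_row_subsampling_transpose)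
  have Mc: "M_r \<in> carrier_mat \<rho>_r p" using row_subsampling_carrier[OF a(13)] .
  have Nc: "M_c \<in> carrier_mat n \<rho>_c" using row_subsampling_carrier[OF N] by simp
  have Pc: "P \<in> carrier_mat p p" and Qc: "Q \<in> carrier_mat n n"
    using a(3,4) unfolding sorted_eigendecomposition_def by auto
  have rip: "(1 - \<delta>) * (frob_norm Y)\<^sup>2
      \<le> (real n * real p) / (real \<rho>_r * real \<rho>_c) * (frob_norm (M_r * Y * (M_c\<^sup>T)\<^sup>T))\<^sup>2"
    if "Y \<in> low_rank_set (first_cols k_r P) (first_cols k_c Q)" for Y
    using a(16) that by simp
  \<comment> \<open>The isometry bound with rows and columns exchanged: transposition swaps the two
    spans and the two samplers and preserves the Frobenius norm.\<close>
  have rip': "(1 - \<delta>) * (frob_norm Y)\<^sup>2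
      \<le> (real p * real n) / (real \<rho>_c * real \<rho>_r) * (frob_norm (M_c\<^sup>T * Y * M_r\<^sup>T))\<^sup>2"
    if Y: "Y \<in> low_rank_set (first_cols k_c Q) (first_cols k_r P)" for Y
  proof -
    have Yc: "Y \<in> carrier_mat n p"
      using Y Pc Qc by (auto simp: low_rank_set_def first_cols_def)
    have "Y\<^sup>T \<in> low_rank_set (first_cols k_r P) (first_cols k_c Q)"
      using Y by (auto simp: low_rank_set_def)
    from rip[OF this] have "(1 - \<delta>) * (frob_norm Y)\<^sup>2
      \<le> (real n * real p) / (real \<rho>_r * real \<rho>_c) * (frob_norm (M_r * Y\<^sup>T * M_c))\<^sup>2"
      by (simp add: frob_norm_transpose)
    moreover have "M_c\<^sup>T * Y * M_r\<^sup>T = (M_r * Y\<^sup>T * M_c)\<^sup>T"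
    proof -
      have "(M_r * Y\<^sup>T * M_c)\<^sup>T = M_c\<^sup>T * (M_r * Y\<^sup>T)\<^sup>T"
        using Mc Nc Yc by (intro transpose_mult) auto
      also have "(M_r * Y\<^sup>T)\<^sup>T = Y * M_r\<^sup>T" using Mc Yc by (simp add: transpose_mult[of _ \<rho>_r p _ n])
      finally show ?thesis using Mc Nc Yc by (simp add: assoc_mult_mat[of _ \<rho>_c n _ p _ \<rho>_r])
    qed
    ultimately show ?thesis by (simp add: frob_norm_transpose mult.commute)
  qed
  have min_r: "is_arg_min (\<lambda>U. trace_mat (U\<^sup>T * L_r * U))
      (\<lambda>U. U \<in> carrier_mat p k \<and> M_r * U = M_r * Ubar) Ustar"
    using a(25) unfolding a(23) .
  have min_c: "is_arg_min (\<lambda>V. trace_mat (V\<^sup>T * L_c * V))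
      (\<lambda>V. V \<in> carrier_mat n k \<and> M_c\<^sup>T * V = M_c\<^sup>T * Vbar) Vstar"
    using a(26) unfolding a(24) .
  show ?thesis
    unfolding a(27,28)
    using subsampled_recovery_bound[OF a(2,1) a(4,3) a(7,8,6) a(17,18) a(13) N a(12,14,11)
        rip a(19,20) min_r]
      subsampled_recovery_bound[OF a(1,2) a(3,4) a(5,6,8) a(18,17) N a(13) a(14,12,11)
        rip' a(21,22) min_c]
    by blast
qed

end
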